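(* Let $\mathcal{G}$ be a $k$-uniform hypergraph. Then the number of connected components of $\mathcal{G}$ equals the Z-geometry connectivity $\beta_Z(\mathcal{G})$, i.e. the maximum number of linearly independent nonnegative Z-eigenvectors of the Laplacian tensor $\mathcal{L}_{\mathcal{G}}$ corresponding to the Z-eigenvalue $0$.
   Context: A $k$-uniform hypergraph $\mathcal{G}$ has vertex set $[n]$ and an edge set $E(\mathcal{G})$ of $k$-element subsets of $[n]$; $d_i$ is the number of edges containing vertex $i$. A path is an alternating sequence $v_0e_1v_1\cdots e_lv_l$ of distinct vertices and distinct edges with $v_{i-1},v_i\in e_i$. For $X\subseteq V$, $\mathcal{G}(X)$ is the induced sub-hypergraph; it is a connected component if any two vertices of $X$ are joined by a path in $\mathcal{G}(X)$ and no path joins a vertex of $X$ to a vertex of $V\setminus X$. The adjacency tensor $\mathcal{A}_{\mathcal{G}}=(a_{i_1\cdots i_k})$ is the $k$-order $n$-dimensional tensor with $a_{i_1\cdots i_k}=\frac{1}{(k-1)!}$ if $\{i_1,\dots,i_k\}\in E(\mathcal{G})$ and $0$ otherwise. The Laplacian tensor is $\mathcal{L}_{\mathcal{G}}=\mathcal{D}_{\mathcal{G}}-\mathcal{A}_{\mathcal{G}}$, where $\mathcal{D}_{\mathcal{G}}$ is the diagonal tensor with diagonal entries $d_1,\dots,d_n$. For a $k$-order $n$-dimensional real tensor $\mathcal{T}=(t_{i_1\cdots i_k})$ and $x\in\mathbb{R}^n$, $(\mathcal{T}x^{k-1})_i=\sum_{i_2,\dots,i_k=1}^n t_{i i_2\cdots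 i_k}x_{i_2}\cdots x_{i_k}$; $\lambda\in\mathbb{R}$ is a Z-eigenvalue with Z-eigenvector $x\in\mathbb{R}^n$ if $\mathcal{T}x^{k-1}=\lambda x$ and $x^{\mathrm T}x=1$. $\beta_Z(\mathcal{G})$ is the maximum number of linearly independent vectors in $\{x\in\mathbb{R}^n_+: \mathcal{L}_{\mathcal{G}}x^{k-1}=0,\ x^{\mathrm T}x=1\}$. *)

theory Defs
  imports "HOL-Analysis.Analysis"
begin

text \<open>A hypergraph on \<open>n\<close> vertices is given by its edge set over a finite vertex type \<open>'n\<close>
  with \<open>CARD('n) = n\<close>.  For sub-hypergraphs the vertex set is an explicit argument.\<close>

definition uniform_hypergraph :: "nat \<Rightarrow> 'n::finite set set \<Rightarrow> bool" where
  "uniform_hypergraph k E \<longleftrightarrow> (\<forall>e\<in>E. card e = k)"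

definition hdegree :: "'n::finite set set \<Rightarrow> 'n \<Rightarrow> nat" where
  "hdegree E i = card {e \<in> E. i \<in> e}"

text \<open>The path \<open>v\<^sub>0 e\<^sub>1 v\<^sub>1 \<dots> e\<^sub>l v\<^sub>l\<close> is represented by its vertex list \<open>vs\<close> and its edge list \<open>es\<close>, so
  that \<open>es ! i\<close> is \<open>e\<^sub>i\<^sub>+\<^sub>1\<close>; the case \<open>l = 0\<close> is allowed.\<close>

definition hpath :: "'n set \<Rightarrow> 'n set set \<Rightarrow> 'n list \<Rightarrow> 'n set list \<Rightarrow> bool" where
  "hpath V E vs es \<longleftrightarrow>
     length vs = Suc (length es) \<and> set vs \<subseteq> V \<and> set es \<subseteq> E \<and> distinct vs \<and> distinct es \<and>
     (\<forall>i<length es. vs ! i \<in> es ! i \<and> vs ! Suc i \<in> es ! i)"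

definition hjoined :: "'n set \<Rightarrow> 'n set set \<Rightarrow> 'n \<Rightarrow> 'n \<Rightarrow> bool" where
  "hjoined V E u v \<longleftrightarrow> (\<exists>vs es. hpath V E vs es \<and> hd vs = u \<and> last vs = v)"

definition induced_edges :: "'n set set \<Rightarrow> 'n set \<Rightarrow> 'n set set" where
  "induced_edges E X = {e \<in> E. e \<subseteq> X}"

definition hcomponent :: "'n::finite set set \<Rightarrow> 'n set \<Rightarrow> bool" where
  "hcomponent E X \<longleftrightarrow> X \<noteq> {} \<and>
     (\<forall>u\<in>X. \<forall>v\<in>X. hjoined X (induced_edges E X) u v) \<and>
     (\<forall>u\<in>X. \<forall>v\<in>UNIV - X. \<not> hjoined UNIV E u v)"

text \<open>A \<open>k\<close>-order tensor with indices in \<open>'n\<close> is a function on index lists, of which only the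
  values on lists of length \<open>k\<close> matter.\<close>

type_synonym 'n tensor = "'n list \<Rightarrow> real"

definition adjacency_tensor :: "nat \<Rightarrow> 'n::finite set set \<Rightarrow> 'n tensor" where
  "adjacency_tensor k E is = (if set is \<in> E then 1 / fact (k - 1) else 0)"

definition degree_tensor :: "nat \<Rightarrow> 'n::finite set set \<Rightarrow> 'n tensor" where
  "degree_tensor k E is = (if \<exists>i. is = replicate k i then real (hdegree E (hd is)) else 0)"

definition laplacian_tensor :: "nat \<Rightarrow> 'n::finite set set \<Rightarrow> 'n tensor" where
  "laplacian_tensor k E is = degree_tensor k E is - adjacency_tensor k E is"

text \<open>The vector \<open>T x\<^sup>k\<^sup>-\<^sup>1\<close>.\<close>

definition tensor_apply :: "nat \<Rightarrow> 'n::finite tensor \<Rightarrow> real ^ 'n \<Rightarrow> real ^ 'n" where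
  "tensor_apply k T x = (\<chi> i. \<Sum>is | length is = k - 1. T (i # is) * (\<Prod>j\<leftarrow>is. x $ j))"

definition Z_eigenpair :: "nat \<Rightarrow> 'n::finite tensor \<Rightarrow> real \<Rightarrow> real ^ 'n \<Rightarrow> bool" where
  "Z_eigenpair k T l x \<longleftrightarrow> tensor_apply k T x = l *\<^sub>R x \<and> x \<bullet> x = 1"

definition nonneg_Z_eigenvectors :: "nat \<Rightarrow> 'n::finite tensor \<Rightarrow> real \<Rightarrow> (real ^ 'n) set" where
  "nonneg_Z_eigenvectors k T l = {x. (\<forall>i. 0 \<le> x $ i) \<and> Z_eigenpair k T l x}"

text \<open>The maximum is over a finite nonempty set, since independent subsets of \<open>real ^ 'n\<close> have at
  most \<open>CARD('n)\<close> elements.\<close>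

definition beta_Z :: "nat \<Rightarrow> 'n::finite set set \<Rightarrow> nat" where
  "beta_Z k E =
     Max {card B | B. B \<subseteq> nonneg_Z_eigenvectors k (laplacian_tensor k E) 0 \<and> independent B}"

end

theory Submission
  imports Defs "HOL-Combinatorics.Multiset_Permutations"
begin

text \<open>
  In coordinates, \<open>(\<L> x\<^sup>k\<^sup>-\<^sup>1)\<^sub>i = d\<^sub>i x\<^sub>i\<^sup>k\<^sup>-\<^sup>1 - \<Sum>\<^sub>e\<^sub>\<ni>\<^sub>i \<Prod>\<^sub>j\<^sub>\<in>\<^sub>e\<^sub>-\<^sub>i x\<^sub>j\<close>. If this vanishes for a nonnegative \<open>x\<close>
  and \<open>i\<close> maximises \<open>x\<close> on its component, then every product over an edge through \<open>i\<close> must attain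
  its upper bound \<open>x\<^sub>i\<^sup>k\<^sup>-\<^sup>1\<close>, so the maximum propagates along edges and \<open>x\<close> is constant on the
  component. Hence the nonnegative null vectors are the nonnegative combinations of the indicator
  vectors of the components, which are pairwise orthogonal.
\<close>

section \<open>Paths, reachability and connected components\<close>

definition hadj :: "'n set set \<Rightarrow> 'n \<Rightarrow> 'n \<Rightarrow> bool" where
  "hadj E u v \<longleftrightarrow> (\<exists>e\<in>E. u \<in> e \<and> v \<in> e)"

text \<open>\<open>hadj\<close> is reflexive only at vertices that lie in an edge. The reflexive
  closure makes an isolated vertex a class of its own, matching the path of length 0.\<close>

definition hclass :: "'n set set \<Rightarrow> 'n \<Rightarrow> 'n set" where
  "hclass E u = {v. (hadj E)\<^sup>*\<^sup>* u v}"

lemma symp_hadj: "symp (hadj E)"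
  by (auto simp: hadj_def symp_def)

lemma hadj_rtranclp_sym: "(hadj E)\<^sup>*\<^sup>* u v \<Longrightarrow> (hadj E)\<^sup>*\<^sup>* v u"
  using symp_hadj[of E] by (metis symp_rtranclp sympD)

lemma hpath_take:
  assumes "hpath V E vs es" "i < length vs"
  shows "hpath V E (take (Suc i) vs) (take i es)"
proof -
  have "set (take (Suc i) vs) \<subseteq> set vs" "set (take i es) \<subseteq> set es"
    by (rule set_take_subset)+
  with assms show ?thesis
    unfolding hpath_def by auto
qed

lemma last_take_Suc: "i < length vs \<Longrightarrow> last (take (Suc i) vs) = vs ! i"
  by (simp add: take_Suc_conv_app_nth)

text \<open>Since a path may repeat neither vertices nor edges, \<open>e\<close> cannot simply be
  appended: the path is first cut short, at \<open>w\<close> itself if it already passes through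
  \<open>w\<close>. This is the extension step for turning reachability into paths.\<close>

lemma hjoined_step:
  assumes "hjoined V E u v" "e \<in> E" "v \<in> e" "w \<in> e" "w \<in> V"
  shows "hjoined V E u w"
proof -
  obtain vs es where p: "hpath V E vs es" "hd vs = u" "last vs = v"
    using assms unfolding hjoined_def by blast
  have ne: "vs \<noteq> []" and len: "length vs = Suc (length es)"
    using p unfolding hpath_def by auto
  show ?thesis
  proof (cases "w \<in> set vs")
    case True
    then obtain i where i: "i < length vs" "vs ! i = w"
      by (auto simp: in_set_conv_nth)
    have "hpath V E (take (Suc i) vs) (take i es)"
      using p i by (intro hpath_take)
    moreover have "hd (take (Suc i) vs) = u" "last (take (Suc i) vs) = w"
      using p ne i by (auto simp: last_take_Suc)
    ultimately show ?thesis
      unfolding hjoined_def by blast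
  next
    case False
    \<comment> \<open>Leaving the path at its first vertex in \<open>e\<close> guarantees that \<open>e\<close> was not used before.\<close>
    define i where "i = (LEAST i. i < length vs \<and> vs ! i \<in> e)"
    have "length es < length vs \<and> vs ! length es \<in> e"
      using p assms len ne by (auto simp: last_conv_nth)
    then have i: "i < length vs" "vs ! i \<in> e"
      unfolding i_def by (rule LeastI2; blast)+
    have least: "vs ! j \<notin> e" if "j < i" for j
      using not_less_Least[of j "\<lambda>i. i < length vs \<and> vs ! i \<in> e"] that i unfolding i_def by auto
    have hp: "hpath V E (take (Suc i) vs) (take i es)"
      using p i by (intro hpath_take)
    have new: "e \<notin> set (take i es)"
    proof
      assume "e \<in> set (take i es)"
      then obtain j where j: "j < i" "j < length es" "es ! j = e"
        by (auto simp: in_set_conv_nth)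
      then show False
        using p least unfolding hpath_def by metis
    qed
    have w: "w \<notin> set (take (Suc i) vs)"
      using False set_take_subset[of "Suc i" vs] by blast
    have li: "length (take i es) = i" "length (take (Suc i) vs) = Suc i"
      using i len by auto
    have "hpath V E (take (Suc i) vs @ [w]) (take i es @ [e])"
      unfolding hpath_def
    proof (intro conjI allI impI)
      fix j assume "j < length (take i es @ [e])"
      then have "j < i \<or> j = i" using li by auto
      then show "(take (Suc i) vs @ [w]) ! j \<in> (take i es @ [e]) ! j"
        and "(take (Suc i) vs @ [w]) ! Suc j \<in> (take i es @ [e]) ! j"
        using hp li i assms unfolding hpath_def by (auto simp: nth_append)
    qed (use hp li new w assms in \<open>auto simp: hpath_def\<close>)
    moreover have "hd (take (Suc i) vs @ [w]) = u"
      using p ne by (cases vs) auto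
    ultimately show ?thesis
      unfolding hjoined_def by (metis last_snoc)
  qed
qed

lemma hjoined_imp_rtranclp:
  assumes "hjoined V E u v"
  shows "(hadj E)\<^sup>*\<^sup>* u v"
proof -
  obtain vs es where p: "hpath V E vs es" "hd vs = u" "last vs = v"
    using assms unfolding hjoined_def by blast
  have len: "length vs = Suc (length es)" and ne: "vs \<noteq> []"
    using p unfolding hpath_def by auto
  have "(hadj E)\<^sup>*\<^sup>* (vs ! 0) (vs ! i)" if "i \<le> length es" for i
    using that
  proof (induction i)
    case (Suc i)
    have "hadj E (vs ! i) (vs ! Suc i)"
      using p Suc.prems unfolding hpath_def hadj_def
      by (metis Suc_le_lessD nth_mem subsetD)
    with Suc show ?case
      by (meson Suc_leD rtranclp.rtrancl_into_rtrancl)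
  qed simp
  from this[of "length es"] show ?thesis
    using p ne len by (simp add: hd_conv_nth last_conv_nth)
qed

text \<open>Requiring only \<open>\<Union>E \<subseteq> V\<close> covers both uses: the whole
  hypergraph with \<open>V = UNIV\<close>, and a class with its induced edges.\<close>

lemma rtranclp_imp_hjoined:
  assumes "(hadj E)\<^sup>*\<^sup>* u v" "\<Union>E \<subseteq> V" "u \<in> V"
  shows "hjoined V E u v"
  using assms(1)
proof (induction rule: rtranclp_induct)
  case base
  have "hpath V E [u] []"
    using assms by (simp add: hpath_def)
  then show ?case
    unfolding hjoined_def by (metis last.simps list.sel(1))
next
  case (step v w)
  then obtain e where "e \<in> E" "v \<in> e" "w \<in> e"
    by (auto simp: hadj_def)
  with step assms show ?case
    by (intro hjoined_step[of V E u v e w]) auto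
qed

lemma hclass_self: "u \<in> hclass E u"
  by (simp add: hclass_def)

lemma hclass_eq: "v \<in> hclass E u \<Longrightarrow> hclass E v = hclass E u"
  unfolding hclass_def using rtranclp_trans[of "hadj E"] hadj_rtranclp_sym[of E] by blast

lemma hclass_edge:
  assumes "v \<in> hclass E u" "e \<in> E" "v \<in> e"
  shows "e \<subseteq> hclass E u"
proof
  fix w assume "w \<in> e"
  then have "hadj E v w"
    using assms by (auto simp: hadj_def)
  then show "w \<in> hclass E u"
    using assms unfolding hclass_def by (simp add: rtranclp.rtrancl_into_rtrancl)
qed

text \<open>An edge that meets a class lies inside it, so passing to the induced sub-hypergraph
  loses no adjacency within the class. Counting components thus becomes counting values of
  \<open>hclass E\<close>.\<close>

lemma hcomponent_iff_hclass: "hcomponent E X \<longleftrightarrow> X \<in> range (hclass E)"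
proof
  assume X: "hcomponent E X"
  then obtain u where u: "u \<in> X"
    unfolding hcomponent_def by blast
  have "X = hclass E u"
  proof
    have "induced_edges E X \<subseteq> E"
      by (auto simp: induced_edges_def)
    then have mono: "(hadj (induced_edges E X))\<^sup>*\<^sup>* \<le> (hadj E)\<^sup>*\<^sup>*"
      by (intro rtranclp_mono) (fastforce simp: hadj_def)
    show "X \<subseteq> hclass E u"
    proof
      fix v assume "v \<in> X"
      then have "hjoined X (induced_edges E X) u v"
        using X u unfolding hcomponent_def by blast
      then show "v \<in> hclass E u"
        using mono by (auto simp: hclass_def dest: hjoined_imp_rtranclp)
    qed
    show "hclass E u \<subseteq> X"
    proof
      fix v assume "v \<in> hclass E u"
      then have "hjoined UNIV E u v"
        by (auto simp: hclass_def intro: rtranclp_imp_hjoined)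
      then show "v \<in> X"
        using X u unfolding hcomponent_def by blast
    qed
  qed
  then show "X \<in> range (hclass E)" by blast
next
  assume "X \<in> range (hclass E)"
  then obtain u where X: "X = hclass E u" by blast
  have "hjoined X (induced_edges E X) v w" if v: "v \<in> X" and w: "w \<in> X" for v w
  proof -
    have "(hadj E)\<^sup>*\<^sup>* v w"
      using v w X hclass_eq[of v E u] by (auto simp: hclass_def)
    \<comment> \<open>Membership in \<open>X\<close> is carried through the induction because it
      forces the next edge to be an induced one.\<close>
    then have "(hadj (induced_edges E X))\<^sup>*\<^sup>* v w \<and> w \<in> X"
    proof (induction rule: rtranclp_induct)
      case (step y z)
      then obtain e where e: "e \<in> E" "y \<in> e" "z \<in> e"
        by (auto simp: hadj_def)
      then have "e \<subseteq> X"
        using step X hclass_edge by metis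
      then have "hadj (induced_edges E X) y z" "z \<in> X"
        using e by (auto simp: hadj_def induced_edges_def)
      with step show ?case
        by (auto intro: rtranclp.rtrancl_into_rtrancl)
    qed (use v in auto)
    then show ?thesis
      using v by (intro rtranclp_imp_hjoined) (auto simp: induced_edges_def)
  qed
  moreover have "\<not> hjoined UNIV E v w" if "v \<in> X" "w \<notin> X" for v w
    using that X hclass_eq[of v E u] hjoined_imp_rtranclp[of UNIV E v w] by (auto simp: hclass_def)
  ultimately show "hcomponent E X"
    using X hclass_self[of u E] unfolding hcomponent_def by blast
qed

section \<open>The Laplacian in coordinates\<close>

text \<open>The index lists belonging to an edge \<open>e\<close> through \<open>i\<close> are the
  \<open>(k - 1)!\<close> orderings of \<open>e - {i}\<close>. They all give the same product, so
  their number cancels the weight \<open>1 / fact (k - 1)\<close>.\<close>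

lemma sum_adjacency_tensor:
  fixes E :: "'n::finite set set" and x :: "real ^ 'n"
  assumes k: "k \<ge> 1" and E: "uniform_hypergraph k E"
  shows "(\<Sum>is | length is = k - 1. adjacency_tensor k E (i # is) * (\<Prod>j\<leftarrow>is. x $ j))
    = (\<Sum>e | e \<in> E \<and> i \<in> e. \<Prod>j\<in>e - {i}. x $ j)"
proof -
  let ?L = "{is :: 'n list. length is = k - 1}"
  have fin: "finite ?L"
    using finite_lists_length_eq[of "UNIV :: 'n set" "k - 1"] by simp
  have fib: "{is \<in> {is \<in> ?L. insert i (set is) \<in> E}. insert i (set is) = e}
      = permutations_of_set (e - {i})" if e: "e \<in> E" "i \<in> e" for e
  proof -
    have ce: "card (e - {i}) = k - 1"
      using e E k by (simp add: uniform_hypergraph_def)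
    show ?thesis
    proof (intro equalityI subsetI)
      fix xs assume "xs \<in> {is \<in> {is \<in> ?L. insert i (set is) \<in> E}. insert i (set is) = e}"
      then have xs: "length xs = k - 1" "insert i (set xs) = e" by auto
      then have sub: "e - {i} \<subseteq> set xs" by auto
      \<comment> \<open>With \<open>k - 1\<close> entries covering the \<open>k - 1\<close> elements
        of \<open>e - {i}\<close>, the list has no room for \<open>i\<close> or for a
        repetition.\<close>
      have "card (set xs) \<le> k - 1"
        using card_length[of xs] xs by simp
      then have eq: "e - {i} = set xs"
        using sub ce by (intro card_seteq) auto
      then have "distinct xs"
        using ce xs by (intro card_distinct) simp
      then show "xs \<in> permutations_of_set (e - {i})"
        using eq by (intro permutations_of_setI) auto
    next
      fix xs assume "xs \<in> permutations_of_set (e - {i})"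
      then have xs: "set xs = e - {i}" "distinct xs"
        by (auto dest: permutations_of_setD)
      then have "length xs = k - 1"
        using ce distinct_card[of xs] by simp
      then show "xs \<in> {is \<in> {is \<in> ?L. insert i (set is) \<in> E}. insert i (set is) = e}"
        using xs e by (auto simp: insert_absorb)
    qed
  qed
  have "(\<Sum>is\<in>?L. adjacency_tensor k E (i # is) * (\<Prod>j\<leftarrow>is. x $ j))
      = (\<Sum>is | is \<in> ?L \<and> insert i (set is) \<in> E. (\<Prod>j\<leftarrow>is. x $ j) / fact (k - 1))"
    using fin by (intro sum.mono_neutral_cong_right) (auto simp: adjacency_tensor_def)
  also have "\<dots> = (\<Sum>e | e \<in> E \<and> i \<in> e.
      \<Sum>is | is \<in> {is \<in> ?L. insert i (set is) \<in> E} \<and> insert i (set is) = e.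
        (\<Prod>j\<leftarrow>is. x $ j) / fact (k - 1))"
    using fin by (intro sum.group[symmetric]) auto
  also have "\<dots> = (\<Sum>e | e \<in> E \<and> i \<in> e. \<Prod>j\<in>e - {i}. x $ j)"
  proof (rule sum.cong[OF refl])
    fix e assume "e \<in> {e. e \<in> E \<and> i \<in> e}"
    then have e: "e \<in> E" "i \<in> e" by auto
    then have ce: "card (e - {i}) = k - 1"
      using E k by (simp add: uniform_hypergraph_def)
    have "(\<Sum>is | is \<in> {is \<in> ?L. insert i (set is) \<in> E} \<and> insert i (set is) = e.
        (\<Prod>j\<leftarrow>is. x $ j) / fact (k - 1))
      = (\<Sum>is\<in>permutations_of_set (e - {i}). (\<Prod>j\<leftarrow>is. x $ j) / fact (k - 1))"
      using fib[OF e] by simp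
    also have "\<dots> = (\<Sum>is\<in>permutations_of_set (e - {i}). (\<Prod>j\<in>e - {i}. x $ j) / fact (k - 1))"
      by (intro sum.cong refl)
        (metis permutations_of_setD prod.distinct_set_conv_list)
    also have "\<dots> = (\<Prod>j\<in>e - {i}. x $ j)"
      using ce by simp
    finally show "(\<Sum>is | is \<in> {is \<in> ?L. insert i (set is) \<in> E} \<and> insert i (set is) = e.
        (\<Prod>j\<leftarrow>is. x $ j) / fact (k - 1)) = (\<Prod>j\<in>e - {i}. x $ j)" .
  qed
  finally show ?thesis by simp
qed

lemma sum_degree_tensor:
  fixes E :: "'n::finite set set" and x :: "real ^ 'n"
  assumes k: "k \<ge> 1"
  shows "(\<Sum>is | length is = k - 1. degree_tensor k E (i # is) * (\<Prod>j\<leftarrow>is. x $ j))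
    = hdegree E i * (x $ i) ^ (k - 1)"
proof -
  have fin: "finite {is :: 'n list. length is = k - 1}"
    using finite_lists_length_eq[of "UNIV :: 'n set" "k - 1"] by simp
  \<comment> \<open>Then \<open>i # is\<close> is constant of length \<open>k\<close> only for
    \<open>is = replicate m i\<close>, so a single term of the sum survives.\<close>
  obtain m where m: "k = Suc m"
    using k by (cases k) auto
  have "(\<Sum>is | length is = k - 1. degree_tensor k E (i # is) * (\<Prod>j\<leftarrow>is. x $ j))
     = (\<Sum>is\<in>{replicate m i}. degree_tensor k E (i # is) * (\<Prod>j\<leftarrow>is. x $ j))"
    using fin m by (intro sum.mono_neutral_right) (auto simp: degree_tensor_def)
  also have "\<dots> = hdegree E i * (x $ i) ^ (k - 1)"
    using m by (auto simp: degree_tensor_def map_replicate)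
  finally show ?thesis .
qed

text \<open>The degree counts the edges through \<open>i\<close>, so the diagonal term can be
  distributed over them. This gives one difference per edge, whose sign can be studied
  separately.\<close>

lemma laplacian_apply_nth:
  fixes E :: "'n::finite set set" and x :: "real ^ 'n"
  assumes "k \<ge> 1" and "uniform_hypergraph k E"
  shows "tensor_apply k (laplacian_tensor k E) x $ i
    = (\<Sum>e | e \<in> E \<and> i \<in> e. (x $ i) ^ (k - 1) - (\<Prod>j\<in>e - {i}. x $ j))"
  using sum_adjacency_tensor[OF assms, of i x] sum_degree_tensor[OF assms(1), of E i x]
  by (simp add: tensor_apply_def laplacian_tensor_def left_diff_distrib sum_subtractf hdegree_def)

section \<open>Nonnegative null vectors are constant on components\<close>

lemma laplacian_apply_eq_0:
  fixes E :: "'n::finite set set" and x :: "real ^ 'n"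
  assumes "k \<ge> 1" and E: "uniform_hypergraph k E"
    and const: "\<And>i j. hadj E i j \<Longrightarrow> x $ i = x $ j"
  shows "tensor_apply k (laplacian_tensor k E) x = 0"
proof -
  have "(\<Prod>j\<in>e - {i}. x $ j) = (x $ i) ^ (k - 1)" if e: "e \<in> E" "i \<in> e" for e i
  proof -
    have "(\<Prod>j\<in>e - {i}. x $ j) = (\<Prod>j\<in>e - {i}. x $ i)"
      using e by (intro prod.cong refl const) (auto simp: hadj_def)
    then show ?thesis
      using e E by (simp add: uniform_hypergraph_def)
  qed
  then show ?thesis
    by (simp add: vec_eq_iff laplacian_apply_nth[OF assms(1) E])
qed

lemma laplacian_null_max_propagates:
  fixes E :: "'n::finite set set" and x :: "real ^ 'n"
  assumes "k \<ge> 1" and E: "uniform_hypergraph k E"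
    and nonneg: "\<And>i. 0 \<le> x $ i"
    and null: "tensor_apply k (laplacian_tensor k E) x = 0"
    and max: "\<And>j. hadj E i j \<Longrightarrow> x $ j \<le> x $ i"
    and ij: "hadj E i j"
  shows "x $ j = x $ i"
proof (rule ccontr)
  assume neq: "x $ j \<noteq> x $ i"
  then have less: "x $ j < x $ i"
    using max[OF ij] by simp
  \<comment> \<open>Positive upper bounds ensure that one strictly smaller factor makes the whole
    product strictly smaller.\<close>
  then have pos: "0 < x $ i"
    using nonneg[of j] by linarith
  obtain e where e: "e \<in> E" "i \<in> e" "j \<in> e"
    using ij by (auto simp: hadj_def)
  have pow: "(\<Prod>j\<in>e - {i}. x $ i) = (x $ i) ^ (k - 1)" if "e \<in> E" "i \<in> e" for e
    using that E by (simp add: uniform_hypergraph_def)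
  have le: "(\<Prod>j\<in>e - {i}. x $ j) \<le> (x $ i) ^ (k - 1)" if "e \<in> E" "i \<in> e" for e
    unfolding pow[OF that, symmetric]
    using that nonneg by (intro prod_mono conjI max) (auto simp: hadj_def)
  have "(\<Prod>j\<in>e - {i}. x $ j) < (\<Prod>j\<in>e - {i}. x $ i)"
    using e less neq nonneg pos
    by (intro prod_mono_strict[of j] conjI max) (auto simp: hadj_def)
  then have "(\<Prod>j\<in>e - {i}. x $ j) < (x $ i) ^ (k - 1)"
    using pow e by simp
  \<comment> \<open>By \<open>le\<close> no summand is negative, and the one for the chosen edge is
    positive.\<close>
  then have "0 < (\<Sum>e | e \<in> E \<and> i \<in> e. (x $ i) ^ (k - 1) - (\<Prod>j\<in>e - {i}. x $ j))"
    using e le by (intro sum_pos2[of _ e]) auto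
  then show False
    using null laplacian_apply_nth[OF assms(1) E, of x i] by simp
qed

text \<open>Starting from a maximiser \<open>m\<close> on the class, each vertex reached attains the
  same maximum, so propagation can be applied again from there.\<close>

lemma laplacian_null_const:
  fixes E :: "'n::finite set set" and x :: "real ^ 'n"
  assumes "k \<ge> 1" "uniform_hypergraph k E"
    and "\<And>i. 0 \<le> x $ i"
    and "tensor_apply k (laplacian_tensor k E) x = 0"
    and v: "v \<in> hclass E u"
  shows "x $ v = x $ u"
proof -
  obtain m where m: "m \<in> hclass E u" and max: "\<And>w. w \<in> hclass E u \<Longrightarrow> x $ w \<le> x $ m"
  proof -
    let ?A = "(\<lambda>w. x $ w) ` hclass E u"
    have "Max ?A \<in> ?A"
      using hclass_self[of u E] by (intro Max_in) auto
    then obtain m where "m \<in> hclass E u" "x $ m = Max ?A" by auto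
    then show ?thesis
      by (intro that[of m]) auto
  qed
  have "x $ w = x $ m \<and> w \<in> hclass E u" if "(hadj E)\<^sup>*\<^sup>* m w" for w
    using that
  proof (induction rule: rtranclp_induct)
    case (step y z)
    \<comment> \<open>The neighbours of \<open>y\<close> stay in the class, hence are bounded by the
      maximum, which is the value at \<open>y\<close>.\<close>
    have cl: "w \<in> hclass E u" if "hadj E y w" for w
      using that step.IH unfolding hclass_def by (auto intro: rtranclp.rtrancl_into_rtrancl)
    then have "x $ z = x $ y"
      using step max by (intro laplacian_null_max_propagates[OF assms(1-4)]) auto
    then show ?case
      using step cl by auto
  qed (use m in auto)
  then have "x $ w = x $ m" if "w \<in> hclass E u" for w
    using that unfolding hclass_eq[OF m, symmetric] unfolding hclass_def by blast
  then show ?thesis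
    using v hclass_self[of u E] by metis
qed

section \<open>Normalised indicators as a basis\<close>

text \<open>The scaling gives norm 1 for nonempty \<open>X\<close>, as the definition of a
  Z-eigenvector demands.\<close>

definition unit_indicator :: "'n::finite set \<Rightarrow> real ^ 'n" where
  "unit_indicator X = (\<chi> i. if i \<in> X then 1 / sqrt (card X) else 0)"

lemma unit_indicator_inner_self:
  assumes "X \<noteq> {}"
  shows "unit_indicator X \<bullet> unit_indicator X = 1"
proof -
  have "unit_indicator X \<bullet> unit_indicator X = (\<Sum>i\<in>UNIV. if i \<in> X then 1 / real (card X) else 0)"
    by (auto simp: inner_vec_def unit_indicator_def intro!: sum.cong)
  also have "\<dots> = (\<Sum>i\<in>X. 1 / real (card X))"
    by (simp add: sum.If_cases)
  also have "\<dots> = 1"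
    using assms by (simp add: card_gt_0_iff)
  finally show ?thesis .
qed

lemma unit_indicator_orthogonal:
  assumes "X \<inter> Y = {}"
  shows "orthogonal (unit_indicator X) (unit_indicator Y)"
  using assms by (auto simp: orthogonal_def inner_vec_def unit_indicator_def intro!: sum.neutral)

lemma hclass_disjoint:
  assumes "X \<in> range (hclass E)" "Y \<in> range (hclass E)" "X \<noteq> Y"
  shows "X \<inter> Y = {}"
  using assms hclass_eq by (metis disjoint_iff rangeE)

text \<open>Distinct classes with equal indicators would yield a unit vector orthogonal to itself.
  Injectivity identifies the number of classes with the number of vectors.\<close>

lemma unit_indicator_inj_on: "inj_on unit_indicator (range (hclass E))"
proof (rule inj_onI, rule ccontr)
  fix X Y assume XY: "X \<in> range (hclass E)" "Y \<in> range (hclass E)"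
    and eq: "unit_indicator X = unit_indicator Y" and "X \<noteq> Y"
  then have "orthogonal (unit_indicator X) (unit_indicator Y)"
    by (intro unit_indicator_orthogonal hclass_disjoint)
  then show False
    using XY eq unit_indicator_inner_self[of X] hclass_self[of _ E]
    by (auto simp: orthogonal_def)
qed

lemma independent_unit_indicators: "independent (unit_indicator ` range (hclass E))"
proof (rule pairwise_orthogonal_independent)
  show "pairwise orthogonal (unit_indicator ` range (hclass E))"
    by (auto simp: pairwise_def intro!: unit_indicator_orthogonal hclass_disjoint)
       (metis IntI empty_iff hclass_disjoint rangeI)
  show "0 \<notin> unit_indicator ` range (hclass E)"
  proof
    assume "0 \<in> unit_indicator ` range (hclass E)"
    then obtain u where "unit_indicator (hclass E u) = 0" by auto
    then show False
      using unit_indicator_inner_self[of "hclass E u"] hclass_self[of u E] by auto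
  qed
qed

lemma unit_indicator_eigenvector:
  fixes E :: "'n::finite set set"
  assumes "k \<ge> 1" and "uniform_hypergraph k E"
  shows "unit_indicator (hclass E u) \<in> nonneg_Z_eigenvectors k (laplacian_tensor k E) 0"
proof -
  have "unit_indicator (hclass E u) $ i = unit_indicator (hclass E u) $ j" if "hadj E i j" for i j
  proof -
    have "i \<in> hclass E u \<longleftrightarrow> j \<in> hclass E u"
      using that hclass_edge[of _ E u] unfolding hadj_def by blast
    then show ?thesis
      by (simp add: unit_indicator_def)
  qed
  then have "tensor_apply k (laplacian_tensor k E) (unit_indicator (hclass E u)) = 0"
    by (intro laplacian_apply_eq_0[OF assms])
  moreover have "unit_indicator (hclass E u) \<bullet> unit_indicator (hclass E u) = 1"
    using hclass_self[of u E] by (intro unit_indicator_inner_self) auto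
  ultimately show ?thesis
    by (simp add: nonneg_Z_eigenvectors_def Z_eigenpair_def unit_indicator_def)
qed

text \<open>Constancy on classes makes \<open>x\<close> a combination of class indicators. The
  coefficient is the common value on the class, multiplied by \<open>sqrt (card X)\<close> to undo
  the normalisation.\<close>

lemma eigenvector_in_span:
  fixes E :: "'n::finite set set"
  assumes "k \<ge> 1" and "uniform_hypergraph k E"
    and x: "x \<in> nonneg_Z_eigenvectors k (laplacian_tensor k E) 0"
  shows "x \<in> span (unit_indicator ` range (hclass E))"
proof -
  have const: "x $ v = x $ u" if "v \<in> hclass E u" for u v
    using x that by (intro laplacian_null_const[OF assms(1,2)])
      (auto simp: nonneg_Z_eigenvectors_def Z_eigenpair_def)
  \<comment> \<open>Any representative of the class serves, since \<open>const\<close> makes the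
    value of \<open>x\<close> independent of the choice.\<close>
  define r where "r X = (SOME u. u \<in> X)" for X :: "'n set"
  let ?c = "\<lambda>X. x $ r X * sqrt (card X)"
  have "x = (\<Sum>X\<in>range (hclass E). ?c X *\<^sub>R unit_indicator X)"
  proof (rule vec_eq_iff[THEN iffD2], rule allI)
    fix i
    have "r (hclass E i) \<in> hclass E i"
      unfolding r_def by (rule someI[of _ i]) (rule hclass_self)
    then have ri: "x $ r (hclass E i) = x $ i"
      by (rule const)
    have "(\<Sum>X\<in>range (hclass E). ?c X *\<^sub>R unit_indicator X) $ i
        = (\<Sum>X\<in>range (hclass E). if X = hclass E i then ?c X * (1 / sqrt (card X)) else 0)"
      unfolding sum_component
    proof (rule sum.cong[OF refl])
      fix X assume "X \<in> range (hclass E)"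
      \<comment> \<open>Classes partition the vertices, so only the class of \<open>i\<close>
        contributes to coordinate \<open>i\<close>.\<close>
      then have "i \<in> X \<longleftrightarrow> X = hclass E i"
        using hclass_eq hclass_self by (metis rangeE)
      then show "(?c X *\<^sub>R unit_indicator X) $ i
          = (if X = hclass E i then ?c X * (1 / sqrt (card X)) else 0)"
        by (simp add: unit_indicator_def)
    qed
    also have "\<dots> = x $ i"
      using ri hclass_self[of i E] by (auto simp: card_gt_0_iff)
    finally show "x $ i = (\<Sum>X\<in>range (hclass E). ?c X *\<^sub>R unit_indicator X) $ i" by simp
  qed
  also have "\<dots> \<in> span (unit_indicator ` range (hclass E))"
    by (intro span_sum span_scale span_base) auto
  finally show ?thesis .
qed

theorem theorem3p4:
  fixes E :: "'n::finite set set" and k :: nat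
  assumes "k \<ge> 1" and "uniform_hypergraph k E"
  shows "card {X. hcomponent E X} = beta_Z k E"
proof -
  let ?S = "unit_indicator ` range (hclass E)"
  let ?N = "nonneg_Z_eigenvectors k (laplacian_tensor k E) 0"
  have card: "card ?S = card {X. hcomponent E X}"
    by (simp add: hcomponent_iff_hclass card_image[OF unit_indicator_inj_on])
  have bound: "card B \<le> card ?S" if "B \<subseteq> ?N" "independent B" for B
  proof -
    have "B \<subseteq> span ?S"
      using that eigenvector_in_span[OF assms] by blast
    then show ?thesis
      using that independent_span_bound[of ?S B] by simp
  qed
  \<comment> \<open>The set \<open>?S\<close> is itself an admissible \<open>B\<close> and attains
    the bound. The same bound supplies the finiteness on which \<open>Max\<close> depends.\<close>
  have "Max {card B | B. B \<subseteq> ?N \<and> independent B} = card ?S"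
  proof (rule Max_eqI)
    show "finite {card B | B. B \<subseteq> ?N \<and> independent B}"
      by (rule finite_subset[of _ "{..card ?S}"]) (use bound in auto)
    show "card ?S \<in> {card B | B. B \<subseteq> ?N \<and> independent B}"
      using unit_indicator_eigenvector[OF assms] independent_unit_indicators[of E] by blast
  qed (use bound in auto)
  then show ?thesis
    using card by (simp add: beta_Z_def)
qed

end
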